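(* Let $\mathcal X,\mathcal Y$ be real separable Hilbert spaces, let $(Y,X)$ be a pair of random variables with values in $\mathcal Y\times\mathcal X$, and let $(Y_i,X_i)_{i=1}^n$ be $n$ independent copies of $(Y,X)$. For each $\lambda\in(0,+\infty)$ let $f_\lambda:\mathcal Y\to\mathcal X$ be measurable, and let $\ell:\mathcal X\times\mathcal X\to[0,+\infty)$ be a measurable loss function bounded by a constant $M>0$. Let $L$ and $\widehat L$ denote the expected and empirical risks. Assume: (i) there is a function $U:(0,+\infty)\to(0,+\infty)$ with $L(f_\lambda)\le U(\lambda)$ for every $\lambda\in(0,+\infty)$; there is $\lambda_*>0$ with $\lambda_*\in\arg\min_{\lambda\in(0,+\infty)}U(\lambda)$; and there is a non-decreasing function $C:[1,+\infty)\to[0,+\infty)$ such that $U(q\lambda_* )\le C(q)\,U(\lambda_* )$ for all $q\ge 1$; (ii) $\Lambda=\{\lambda_1,\dots,\lambda_N\}$ with $N\geq 2$, $0<\lambda_1\le\dots\le\lambda_N<\infty$, $\lambda_*\in[\lambda_1,\lambda_N]$, and $\lambda_j=\lambda_1Q^{j-1}$ for every $j=1,\dots,N$, where $Q=(\lambda_N/\lambda_1)^{1/(N-1)}$. Let $\widehat\lambda_\Lambda\in\arg\min_{\lambda\in\Lambda}\widehat L(f_\lambda)$ and let $\eta\in(0,1)$. Then, with probability at least $1-\eta$, $$L(f_{\widehat\lambda_\Lambda})\le 2\,C(Q)\,U(\lambda_* )+\frac{13M}{2n}\log\frac{2N}{\eta}.$$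
   Context: For a measurable $f:\mathcal Y\to\mathcal X$, the expected risk is $L(f)=\mathbb E[\ell(f(Y),X)]$ and the empirical risk is $\widehat L(f)=\frac1n\sum_{i=1}^n\ell(f(Y_i),X_i)$. The parameter $\widehat\lambda_\Lambda$ is a random variable (it depends on the sample $(Y_i,X_i)_{i=1}^n$), and $L(f_{\widehat\lambda_\Lambda})$ denotes the value of the deterministic function $\lambda\mapsto L(f_\lambda)$ at $\lambda=\widehat\lambda_\Lambda$; the probability is with respect to the sample. *)

theory Defs
  imports "HOL-Probability.Probability"
begin

definition expected_risk ::
  "'w measure \<Rightarrow> ('w \<Rightarrow> 'y) \<Rightarrow> ('w \<Rightarrow> 'x) \<Rightarrow> ('x \<Rightarrow> 'x \<Rightarrow> real) \<Rightarrow> ('y \<Rightarrow> 'x) \<Rightarrow> real" where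
  "expected_risk P Y X loss f = (\<integral>\<omega>. loss (f (Y \<omega>)) (X \<omega>) \<partial>P)"

(* The sample is indexed by 1, ..., n. *)
definition empirical_risk ::
  "nat \<Rightarrow> (nat \<Rightarrow> 'w \<Rightarrow> 'y) \<Rightarrow> (nat \<Rightarrow> 'w \<Rightarrow> 'x) \<Rightarrow> ('x \<Rightarrow> 'x \<Rightarrow> real) \<Rightarrow> ('y \<Rightarrow> 'x) \<Rightarrow> 'w \<Rightarrow> real" where
  "empirical_risk n Ys Xs loss f \<omega> =
     1 / real n * (\<Sum>i = 1..n. loss (f (Ys i \<omega>)) (Xs i \<omega>))"

definition iid_copies ::
  "'w measure \<Rightarrow> 'a measure \<Rightarrow> ('w \<Rightarrow> 'a) \<Rightarrow> nat \<Rightarrow> (nat \<Rightarrow> 'w \<Rightarrow> 'a) \<Rightarrow> bool" where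
  "iid_copies P S Z n Zs \<longleftrightarrow>
     prob_space.indep_vars P (\<lambda>_. S) Zs {1..n} \<and>
     (\<forall>i\<in>{1..n}. distr P S (Zs i) = distr P S Z)"

end

theory Submission
  imports Defs
begin

text \<open>
  For \<open>g, h\<close> with values in \<open>[0, b]\<close> the pointwise bound
  \<open>2 powr ((h - g) / b) \<le> 1 + h / b - g / (2 * b)\<close> and Markov's inequality show that
  the empirical mean of \<open>g\<close> is at most that of \<open>h\<close> with probability at most
  \<open>exp (- n / b * (E g / 2 - E h))\<close>. Taking for \<open>h\<close> the loss at the smallest grid point
  above the minimiser of \<open>U\<close>, and for \<open>g\<close> the loss at a grid point whose risk exceeds the
  claimed bound, this limits the probability that the latter is selected; a union bound over the
  grid finishes the proof.
\<close>

section \<open>Elementary bounds on powers of two and one half\<close>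

lemma two_powr_le_one_plus:
  fixes x :: real
  assumes "0 \<le> x" "x \<le> 1"
  shows "2 powr x \<le> 1 + x"
  \<comment> \<open>Weighted AM-GM for 2 and 1 with weights \<open>x\<close> and
    \<open>1 - x\<close>: the exponential lies below its chord.\<close>
  using Youngs_inequality_0[of x "1 - x" 2 1] assms by (simp add: algebra_simps)

lemma half_powr_le_one_minus:
  fixes x :: real
  assumes "0 \<le> x" "x \<le> 1"
  shows "(1/2) powr x \<le> 1 - x / 2"
  using Youngs_inequality_0[of x "1 - x" "1/2" 1] assms by (simp add: algebra_simps)

text \<open>The two chord bounds are multiplied, and the cross term \<open>- x * y / 2\<close> is
  dropped because it is nonpositive. With a base \<open>c > 1\<close> the slopes would be
  \<open>c - 1\<close> in \<open>y\<close> and \<open>1 - 1 / c\<close> in \<open>x\<close>, of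
  ratio \<open>c\<close>; base 2 thus yields the factor 2 in the final risk bound.\<close>

lemma two_powr_diff_le:
  fixes x y :: real
  assumes "0 \<le> x" "x \<le> 1" "0 \<le> y" "y \<le> 1"
  shows "2 powr (y - x) \<le> 1 + y - x / 2"
proof -
  have "2 powr (y - x) = 2 powr y * (1/2) powr x"
    by (simp add: powr_diff powr_divide)
  also have "\<dots> \<le> (1 + y) * (1 - x / 2)"
    using assms by (intro mult_mono two_powr_le_one_plus half_powr_le_one_minus) auto
  also have "\<dots> \<le> 1 + y - x / 2"
    using assms by (simp add: algebra_simps)
  finally show ?thesis .
qed

section \<open>Exponential inequality for independent copies\<close>

lemma (in prob_space) iid_copies_measurable:
  assumes "iid_copies M S Z n Zs" "i \<in> {1..n}"
  shows "Zs i \<in> measurable M S"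
  using assms unfolding iid_copies_def indep_vars_def by auto

lemma (in prob_space) iid_copies_expectation:
  fixes g :: "'b \<Rightarrow> real"
  assumes iid: "iid_copies M S Z n Zs" and Z: "Z \<in> measurable M S"
    and g: "g \<in> borel_measurable S" and i: "i \<in> {1..n}"
  shows "expectation (\<lambda>\<omega>. g (Zs i \<omega>)) = expectation (\<lambda>\<omega>. g (Z \<omega>))"
proof -
  have "distr M S (Zs i) = distr M S Z"
    using iid i unfolding iid_copies_def by auto
  then show ?thesis
    using integral_distr[OF iid_copies_measurable[OF iid i] g] integral_distr[OF Z g] by simp
qed

text \<open>A Chernoff argument applied directly to the difference of the two sums, so no
  concentration of either sum around its mean is used. For \<open>n \<ge> 1\<close> the bound is
  below 1 exactly when the mean of \<open>g\<close> exceeds twice that of \<open>h\<close>.\<close>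

lemma (in prob_space) prob_iid_sum_le:
  fixes g h :: "'b \<Rightarrow> real" and b :: real
  assumes iid: "iid_copies M S Z n Zs" and Z: "Z \<in> measurable M S"
    and g [measurable]: "g \<in> borel_measurable S" and h [measurable]: "h \<in> borel_measurable S"
    and b: "b > 0"
    and g_bd: "\<And>z. 0 \<le> g z \<and> g z \<le> b" and h_bd: "\<And>z. 0 \<le> h z \<and> h z \<le> b"
  shows "prob {\<omega> \<in> space M. (\<Sum>i=1..n. g (Zs i \<omega>)) \<le> (\<Sum>i=1..n. h (Zs i \<omega>))}
           \<le> exp (- (real n / b)
                    * (expectation (\<lambda>\<omega>. g (Z \<omega>)) / 2 - expectation (\<lambda>\<omega>. h (Z \<omega>))))"
proof -
  define k where "k z = 2 powr ((h z - g z) / b)" for z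
  define W where "W \<omega> = (\<Prod>i\<in>{1..n}. k (Zs i \<omega>))" for \<omega>
  \<comment> \<open>The excess over 1 of the integrated pointwise bound on \<open>k\<close>.\<close>
  define r where "r = (expectation (\<lambda>\<omega>. h (Z \<omega>)) - expectation (\<lambda>\<omega>. g (Z \<omega>)) / 2) / b"
  have k_meas [measurable]: "k \<in> borel_measurable S"
    unfolding k_def by measurable
  have k_nonneg: "k z \<ge> 0" for z
    by (simp add: k_def)
  have k_le: "k z \<le> 1 + h z / b - g z / b / 2" for z
    using two_powr_diff_le[of "g z / b" "h z / b"] g_bd[of z] h_bd[of z] b
    by (simp add: k_def diff_divide_distrib)
  have k_le_2: "k z \<le> 2" for z
  proof -
    have "h z / b \<le> 1" "0 \<le> g z / b / 2"
      using g_bd[of z] h_bd[of z] b by auto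
    then show ?thesis using k_le[of z] by linarith
  qed
  note Zs_meas = iid_copies_measurable[OF iid]
  have int_g: "integrable M (\<lambda>\<omega>. g (Z \<omega>))"
    using g_bd Z by (intro integrable_const_bound[where B = b]) auto
  have int_h: "integrable M (\<lambda>\<omega>. h (Z \<omega>))"
    using h_bd Z by (intro integrable_const_bound[where B = b]) auto
  have int_kZ: "integrable M (\<lambda>\<omega>. k (Z \<omega>))"
    using k_nonneg k_le_2 Z by (intro integrable_const_bound[where B = 2]) auto
  have int_kZs: "integrable M (\<lambda>\<omega>. k (Zs i \<omega>))" if "i \<in> {1..n}" for i
    using k_nonneg k_le_2 measurable_compose[OF Zs_meas[OF that] k_meas]
    by (intro integrable_const_bound[where B = 2]) auto
  have "expectation (\<lambda>\<omega>. k (Z \<omega>)) \<le> expectation (\<lambda>\<omega>. 1 + h (Z \<omega>) / b - g (Z \<omega>) / b / 2)"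
    using int_g int_h int_kZ k_le by (intro integral_mono) auto
  also have "\<dots> = 1 + r"
    using int_g int_h b by (simp add: r_def field_simps prob_space)
  \<comment> \<open>In this form the \<open>n\<close>-fold product of the expectations becomes
    \<open>exp (n * r)\<close>.\<close>
  also have "\<dots> \<le> exp r"
    by (rule exp_ge_add_one_self)
  finally have k_exp: "expectation (\<lambda>\<omega>. k (Z \<omega>)) \<le> exp r" .
  have ind: "indep_vars (\<lambda>_. borel) (\<lambda>i \<omega>. k (Zs i \<omega>)) {1..n}"
    using iid k_meas unfolding iid_copies_def
    by (blast intro: indep_vars_compose2[where M' = "\<lambda>_. S" and Y = "\<lambda>_. k" and X = Zs])
  have W_nonneg: "W \<omega> \<ge> 0" for \<omega>
    unfolding W_def using k_nonneg by (intro prod_nonneg) auto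
  have int_W: "integrable M W"
    unfolding W_def using ind int_kZs by (intro indep_vars_integrable) auto
  have "expectation W = (\<Prod>i\<in>{1..n}. expectation (\<lambda>\<omega>. k (Zs i \<omega>)))"
    unfolding W_def using ind int_kZs by (intro indep_vars_lebesgue_integral) auto
  also have "\<dots> = expectation (\<lambda>\<omega>. k (Z \<omega>)) ^ n"
    using iid_copies_expectation[OF iid Z k_meas] by simp
  also have "\<dots> \<le> exp r ^ n"
    using k_exp k_nonneg by (intro power_mono) (auto intro: integral_nonneg)
  also have "\<dots> = exp (real n * r)"
    by (simp add: exp_of_nat_mult)
  finally have W_exp: "expectation W \<le> exp (real n * r)" .
  \<comment> \<open>On the event the exponent of 2 in \<open>W\<close> is nonnegative, which
    prepares Markov's inequality at threshold 1.\<close>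
  have "{\<omega> \<in> space M. (\<Sum>i=1..n. g (Zs i \<omega>)) \<le> (\<Sum>i=1..n. h (Zs i \<omega>))}
          \<subseteq> {\<omega> \<in> space M. 1 \<le> W \<omega>}"
  proof safe
    fix \<omega>
    assume le: "(\<Sum>i=1..n. g (Zs i \<omega>)) \<le> (\<Sum>i=1..n. h (Zs i \<omega>))"
    have "W \<omega> = 2 powr (\<Sum>i=1..n. (h (Zs i \<omega>) - g (Zs i \<omega>)) / b)"
      unfolding W_def k_def by (simp add: powr_sum)
    also have "(\<Sum>i=1..n. (h (Zs i \<omega>) - g (Zs i \<omega>)) / b)
                 = ((\<Sum>i=1..n. h (Zs i \<omega>)) - (\<Sum>i=1..n. g (Zs i \<omega>))) / b"
      by (simp add: sum_subtractf sum_divide_distrib[symmetric])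
    finally show "1 \<le> W \<omega>"
      using le b by (simp add: ge_one_powr_ge_zero)
  qed
  moreover have "W \<in> borel_measurable M"
    using int_W by auto
  ultimately have "prob {\<omega> \<in> space M. (\<Sum>i=1..n. g (Zs i \<omega>)) \<le> (\<Sum>i=1..n. h (Zs i \<omega>))}
      \<le> prob {\<omega> \<in> space M. 1 \<le> W \<omega>}"
    by (intro finite_measure_mono) auto
  also have "\<dots> \<le> expectation W / 1"
    using int_W W_nonneg by (intro integral_Markov_inequality_measure[where A = "{}"]) auto
  also have "\<dots> \<le> exp (real n * r)"
    using W_exp by simp
  also have "real n * r = - (real n / b)
      * (expectation (\<lambda>\<omega>. g (Z \<omega>)) / 2 - expectation (\<lambda>\<omega>. h (Z \<omega>)))"
    using b by (simp add: r_def field_simps)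
  finally show ?thesis .
qed

section \<open>Neighbours in a geometric grid\<close>

lemma geometric_grid_upper_neighbour:
  fixes lam :: "nat \<Rightarrow> real" and q x :: real
  assumes grid: "\<And>j. j \<in> {1..N} \<Longrightarrow> lam j = lam 1 * q ^ (j - 1)"
    and q: "q \<ge> 1" and x: "x \<in> {lam 1..lam N}" and pos: "lam 1 > 0" and N: "N \<ge> 1"
  obtains j where "j \<in> {1..N}" "x \<le> lam j" "lam j \<le> q * x"
proof -
  \<comment> \<open>The least such index is the witness. The conjunct \<open>1 \<le> j\<close>
    excludes index 0, about which \<open>grid\<close> says nothing.\<close>
  define above where "above j \<longleftrightarrow> 1 \<le> j \<and> x \<le> lam j" for j
  define j where "j = (LEAST j. above j)"
  have "above N"
    using x N by (simp add: above_def)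
  then have j: "1 \<le> j" "x \<le> lam j" and "j \<le> N"
    using LeastI[of above N] Least_le[of above N] by (simp_all add: j_def above_def)
  have "lam j \<le> q * x"
  proof (cases "j = 1")
    case True
    have "lam 1 \<le> x" "x \<le> q * x"
      using x pos q by (auto simp: mult_le_cancel_right1)
    then show ?thesis
      using True by simp
  next
    case False
    \<comment> \<open>Here the predecessor \<open>Suc m\<close> is still a grid index, so minimality
      puts its grid point below \<open>x\<close>, and one factor \<open>q\<close> leads to
      \<open>lam j\<close>.\<close>
    then obtain m where m: "j = Suc (Suc m)"
      using j(1) by (cases j rule: nat.exhaust; cases "j - 1") auto
    have "lam (Suc m) < x"
      using not_less_Least[of "Suc m" above] m unfolding j_def[symmetric] by (simp add: above_def)
    moreover have "lam j = q * lam (Suc m)"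
      using grid[of j] grid[of "Suc m"] m \<open>j \<le> N\<close> by simp
    ultimately show ?thesis
      using q by simp
  qed
  then show thesis
    using that j \<open>j \<le> N\<close> by auto
qed

section \<open>Risk bound for the empirical minimiser over the grid\<close>

theorem theorem1:
  fixes P :: "'w measure"
    and Y :: "'w \<Rightarrow> 'y::{real_inner, polish_space}"
    and X :: "'w \<Rightarrow> 'x::{real_inner, polish_space}"
    and Ys :: "nat \<Rightarrow> 'w \<Rightarrow> 'y"
    and Xs :: "nat \<Rightarrow> 'w \<Rightarrow> 'x"
    and n N :: nat
    and f :: "real \<Rightarrow> 'y \<Rightarrow> 'x"
    and loss :: "'x \<Rightarrow> 'x \<Rightarrow> real"
    and U C :: "real \<Rightarrow> real"
    and lam :: "nat \<Rightarrow> real"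
    and lam_star M Q \<eta> :: real
    and lam_hat :: "'w \<Rightarrow> real"
  assumes "prob_space P"
    and "(\<lambda>\<omega>. (Y \<omega>, X \<omega>)) \<in> measurable P (borel \<Otimes>\<^sub>M borel)"
    and "n \<ge> 1"
    and "iid_copies P (borel \<Otimes>\<^sub>M borel) (\<lambda>\<omega>. (Y \<omega>, X \<omega>)) n (\<lambda>i \<omega>. (Ys i \<omega>, Xs i \<omega>))"
    and "\<And>l. l > 0 \<Longrightarrow> f l \<in> measurable borel borel"
    and "(\<lambda>(a, b). loss a b) \<in> borel_measurable (borel \<Otimes>\<^sub>M borel)"
    and "M > 0"
    and "\<And>a b. 0 \<le> loss a b \<and> loss a b \<le> M"
    and "\<And>l. l > 0 \<Longrightarrow> U l > 0"
    and "\<And>l. l > 0 \<Longrightarrow> expected_risk P Y X loss (f l) \<le> U l"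
    and "is_arg_min U (\<lambda>l. l > 0) lam_star"
    and "\<And>q. q \<ge> 1 \<Longrightarrow> C q \<ge> 0"
    and "mono_on {1..} C"
    and "\<And>q. q \<ge> 1 \<Longrightarrow> U (q * lam_star) \<le> C q * U lam_star"
    and "N \<ge> 2"
    and "lam 1 > 0"
    and "mono_on {1..N} lam"
    and "lam_star \<in> {lam 1..lam N}"
    and "Q = (lam N / lam 1) powr (1 / (real N - 1))"
    and "\<And>j. j \<in> {1..N} \<Longrightarrow> lam j = lam 1 * Q ^ (j - 1)"
    and "lam_hat \<in> borel_measurable P"
    and "\<And>\<omega>. \<omega> \<in> space P \<Longrightarrow>
           is_arg_min (\<lambda>l. empirical_risk n Ys Xs loss (f l) \<omega>) (\<lambda>l. l \<in> lam ` {1..N}) (lam_hat \<omega>)"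
    and "0 < \<eta>" and "\<eta> < 1"
  shows "\<P>(\<omega> in P. expected_risk P Y X loss (f (lam_hat \<omega>))
            \<le> 2 * C Q * U lam_star + 13 * M / (2 * real n) * ln (2 * real N / \<eta>)) \<ge> 1 - \<eta>"
proof -
  interpret prob_space P by fact
  note M_pos = assms(7) and loss_bd = assms(8)
  define S where "S = (borel \<Otimes>\<^sub>M borel :: ('y \<times> 'x) measure)"
  define Z where "Z \<omega> = (Y \<omega>, X \<omega>)" for \<omega>
  define Zs where "Zs i \<omega> = (Ys i \<omega>, Xs i \<omega>)" for i \<omega>
  define g where "g l z = loss (f l (fst z)) (snd z)" for l z
  define L where "L l = expected_risk P Y X loss (f l)" for l
  define K where "K = 13 * M / (2 * real n) * ln (2 * real N / \<eta>)"
  define B where "B = 2 * C Q * U lam_star + K"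
  have Z: "Z \<in> measurable P S" and iid: "iid_copies P S Z n Zs"
    using assms(2,4) unfolding S_def Z_def[abs_def] Zs_def[abs_def] by auto
  have g_meas: "g l \<in> borel_measurable S" if "l > 0" for l
  proof -
    have [measurable]: "f l \<in> measurable borel borel"
      using assms(5) that .
    have "(\<lambda>z. (\<lambda>(a, b). loss a b) (f l (fst z), snd z)) \<in> borel_measurable S"
      unfolding S_def by (rule measurable_compose[OF _ assms(6)]) measurable
    then show ?thesis
      by (simp add: g_def[abs_def])
  qed
  have L_eq: "L l = expectation (\<lambda>\<omega>. g l (Z \<omega>))" for l
    by (simp add: L_def expected_risk_def g_def Z_def)
  have lam_N: "lam 1 \<le> lam N"
    using assms(17,15) by (auto simp: mono_on_def)
  have Q: "Q \<ge> 1"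
    unfolding assms(19) using lam_N assms(16,15) by (intro ge_one_powr_ge_zero) auto
  have lam_pos: "lam j > 0" if "j \<in> {1..N}" for j
    using assms(20)[OF that] assms(16) Q by simp
  \<comment> \<open>The neighbour above \<open>lam_star\<close> is taken because the growth
    condition on \<open>U\<close> concerns only factors \<open>q \<ge> 1\<close>.\<close>
  obtain m where m: "m \<in> {1..N}" "lam_star \<le> lam m" "lam m \<le> Q * lam_star"
  proof (rule geometric_grid_upper_neighbour[OF assms(20) Q assms(18,16)])
    show "N \<ge> 1" using assms(15) by simp
  qed
  have star_pos: "lam_star > 0"
    using assms(16,18) by auto
  have L_m: "L (lam m) \<le> C Q * U lam_star"
  proof -
    define q where "q = lam m / lam_star"
    have q: "1 \<le> q" "q \<le> Q" "q * lam_star = lam m"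
      using m star_pos by (auto simp: q_def field_simps)
    have "L (lam m) \<le> U (q * lam_star)"
      unfolding L_def q(3) using assms(10) lam_pos m by auto
    also have "\<dots> \<le> C q * U lam_star"
      using assms(14)[OF q(1)] .
    also have "\<dots> \<le> C Q * U lam_star"
      using assms(13) q Q assms(9)[OF star_pos]
      by (intro mult_right_mono) (auto simp: mono_on_def)
    finally show ?thesis .
  qed
  have empirical: "empirical_risk n Ys Xs loss (f l) \<omega> = (\<Sum>i=1..n. g l (Zs i \<omega>)) / real n" for l \<omega>
    by (simp add: empirical_risk_def g_def Zs_def)
  \<comment> \<open>The bad grid points, collected as values rather than indices, so coinciding
    points (\<open>Q = 1\<close>) count once in the union bound.\<close>
  define J where "J = {l \<in> lam ` {1..N}. B < L l}"
  have hat: "lam_hat \<omega> \<in> lam ` {1..N}"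
      "empirical_risk n Ys Xs loss (f (lam_hat \<omega>)) \<omega> \<le> empirical_risk n Ys Xs loss (f (lam m)) \<omega>"
    if "\<omega> \<in> space P" for \<omega>
    using assms(22)[OF that] m(1) unfolding is_arg_min_linorder by auto
  have hat_meas: "{\<omega> \<in> space P. lam_hat \<omega> = l} \<in> events" for l
    using assms(21) by simp
  \<comment> \<open>For a fixed \<open>l\<close>, selecting \<open>l\<close> forces its empirical
    risk to be at most that of \<open>lam m\<close>, an event about two deterministic
    parameters.\<close>
  have bad: "prob {\<omega> \<in> space P. lam_hat \<omega> = l} \<le> \<eta> / real N" if "l \<in> J" for l
  proof -
    have l: "l > 0" "B < L l"
      using that lam_pos by (auto simp: J_def)
    have lam_m: "lam m > 0"
      using lam_pos m by auto
    have sum_meas: "(\<lambda>\<omega>. \<Sum>i=1..n. g l' (Zs i \<omega>)) \<in> borel_measurable P" if "l' > 0" for l'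
      using measurable_compose[OF iid_copies_measurable[OF iid] g_meas[OF that]] by (intro borel_measurable_sum)
    have "prob {\<omega> \<in> space P. lam_hat \<omega> = l}
        \<le> prob {\<omega> \<in> space P. (\<Sum>i=1..n. g l (Zs i \<omega>)) \<le> (\<Sum>i=1..n. g (lam m) (Zs i \<omega>))}"
    proof (rule finite_measure_mono)
      show "{\<omega> \<in> space P. lam_hat \<omega> = l}
          \<subseteq> {\<omega> \<in> space P. (\<Sum>i=1..n. g l (Zs i \<omega>)) \<le> (\<Sum>i=1..n. g (lam m) (Zs i \<omega>))}"
        using hat(2) assms(3) by (auto simp: empirical divide_le_cancel)
      show "{\<omega> \<in> space P. (\<Sum>i=1..n. g l (Zs i \<omega>)) \<le> (\<Sum>i=1..n. g (lam m) (Zs i \<omega>))} \<in> events"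
        using sum_meas[of l] sum_meas[of "lam m"] l lam_m by simp
    qed
    also have "\<dots> \<le> exp (- (real n / M) * (L l / 2 - L (lam m)))"
      unfolding L_eq using loss_bd M_pos
      by (intro prob_iid_sum_le[OF iid Z g_meas[OF l(1)] g_meas[OF lam_m]]) (auto simp: g_def)
    also have "\<dots> \<le> exp (- ln (2 * real N / \<eta>))"
    proof -
      have ln_nonneg: "ln (2 * real N / \<eta>) \<ge> 0"
        using assms(15,23,24) by (intro ln_ge_zero) (auto simp: field_simps)
      \<comment> \<open>Halving \<open>B\<close> turns \<open>2 * C Q * U lam_star\<close> into the
        bound on \<open>L (lam m)\<close>, so the two cancel and \<open>K / 2\<close> is left.
        Scaled by \<open>n / M\<close> this is 13/4 of the logarithm, which is at least the
        logarithm itself as that is nonnegative.\<close>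
      have "K / 2 \<le> L l / 2 - L (lam m)"
        using l(2) L_m unfolding B_def by linarith
      then have "real n / M * (K / 2) \<le> real n / M * (L l / 2 - L (lam m))"
        using M_pos by (intro mult_left_mono) auto
      moreover have "real n / M * (K / 2) = 13 / 4 * ln (2 * real N / \<eta>)"
        using M_pos assms(3) by (simp add: K_def)
      ultimately show ?thesis
        using ln_nonneg unfolding exp_le_cancel_iff mult_minus_left by linarith
    qed
    also have "\<dots> = \<eta> / (2 * real N)"
      using assms(15,23) by (simp add: exp_minus)
    also have "\<dots> \<le> \<eta> / real N"
      using assms(15,23) by (simp add: field_simps)
    finally show ?thesis .
  qed
  have J: "finite J" "card J \<le> N"
    using card_mono[of "lam ` {1..N}" J] card_image_le[of "{1..N}" lam] by (auto simp: J_def)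
  have "prob (\<Union>l\<in>J. {\<omega> \<in> space P. lam_hat \<omega> = l}) \<le> (\<Sum>l\<in>J. prob {\<omega> \<in> space P. lam_hat \<omega> = l})"
    using J hat_meas by (intro finite_measure_subadditive_finite) auto
  also have "\<dots> \<le> real (card J) * (\<eta> / real N)"
    using bad by (rule sum_bounded_above)
  also have "\<dots> \<le> real N * (\<eta> / real N)"
    using J assms(23) by (intro mult_right_mono) auto
  also have "\<dots> = \<eta>"
    using assms(15) by simp
  finally have "1 - \<eta> \<le> 1 - prob (\<Union>l\<in>J. {\<omega> \<in> space P. lam_hat \<omega> = l})"
    by simp
  also have "\<dots> = prob (space P - (\<Union>l\<in>J. {\<omega> \<in> space P. lam_hat \<omega> = l}))"
    using J hat_meas by (intro prob_compl[symmetric] sets.finite_UN) auto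
  \<comment> \<open>As \<open>lam_hat\<close> takes its values in the grid, avoiding
    \<open>J\<close> means exactly that the risk bound holds.\<close>
  also have "space P - (\<Union>l\<in>J. {\<omega> \<in> space P. lam_hat \<omega> = l}) = {\<omega> \<in> space P. L (lam_hat \<omega>) \<le> B}"
    using hat(1) by (auto simp: J_def not_less)
  finally show ?thesis
    by (simp add: L_def B_def K_def)
qed

end
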